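(* The $\mathcal{L}$-processes are not Feller processes; that is, no $\mathcal{L}$-process is a Feller process.
   Context: Fix $\nu\in(1/2,1)$ and let $b(t,x)=I_{t>0}\,t^{-\nu}\operatorname{sign}x$ for $(t,x)\in\mathbb{R}^2$, $\mathcal{L}u=\partial_tu+\tfrac12D^2u+b\,Du$, where $\partial_t=\partial/\partial t$, $D=\partial/\partial x$. An $\mathcal{L}$-process is a strong Markov $\mathbb{R}^2$-valued diffusion process $X=((\mathsf{t}_s,x_s),P_{t,x})$, $s\ge0$, $(t,x)\in\mathbb{R}^2$, such that for every $(t,x)\in\mathbb{R}^2$ the distribution of its trajectories under $P_{t,x}$ is the distribution of a solution, for some one-dimensional Wiener process $w$ on some probability space, of the system $$\mathsf{t}_s=t+s,\qquad x_s=x+w_s+\int_0^s I_{\mathsf{t}_r>0}\,\mathsf{t}_r^{-\nu}\operatorname{sign}x_r\,dr,\qquad s\ge0.$$ Such a process is called Feller if for every $s\ge0$ and every bounded continuous function $f$ on $\mathbb{R}^2$ the function $(t,x)\mapsto E_{t,x}f(\mathsf{t}_s,x_s)$ is continuous on $\mathbb{R}^2$, where $E_{t,x}$ is the expectation with respect to $P_{t,x}$. *)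

theory Defs
  imports "HOL-Probability.Probability"
begin

section \<open>Wiener processes\<close>

locale wiener_process = prob_space W
  for W :: "'w measure" and w :: "real \<Rightarrow> 'w \<Rightarrow> real" +
  assumes measurable_w: "0 \<le> s \<Longrightarrow> w s \<in> borel_measurable W"
    and start_w: "AE \<omega> in W. w 0 \<omega> = 0"
    and continuous_w: "AE \<omega> in W. continuous_on {0..} (\<lambda>s. w s \<omega>)"
    and indep_increments: "0 \<le> \<tau> 0 \<Longrightarrow> (\<And>i. i < n \<Longrightarrow> \<tau> i < \<tau> (Suc i)) \<Longrightarrow>
      indep_vars (\<lambda>_. borel) (\<lambda>i \<omega>. w (\<tau> (Suc i)) \<omega> - w (\<tau> i) \<omega>) {..<(n::nat)}"
    and normal_increments: "0 \<le> s \<Longrightarrow> s < t \<Longrightarrow>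
      distributed W lborel (\<lambda>\<omega>. w t \<omega> - w s \<omega>) (normal_density 0 (sqrt (t - s)))"

section \<open>Strong Markov diffusion processes\<close>

text \<open>Times are nonnegative reals; values of a process at negative indices carry no meaning.
  The filtration is indexed by \<^typ>\<open>ennreal\<close> so that stopping times may take the value
  \<^term>\<open>\<infinity>\<close>; at index \<^term>\<open>\<infinity>\<close> it is generated by the whole process.\<close>

definition natural_filtration ::
    "'a measure \<Rightarrow> (real \<Rightarrow> 'a \<Rightarrow> 's::topological_space) \<Rightarrow> ennreal \<Rightarrow> 'a measure" where
  "natural_filtration M X t =
     sigma (space M) {X s -` B \<inter> space M | s B. 0 \<le> s \<and> ennreal s \<le> t \<and> B \<in> sets borel}"

lemma filtration_natural_filtration: "filtration (space M) (natural_filtration M X)"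
proof
  have sub: "{X s -` B \<inter> space M | s B. 0 \<le> s \<and> ennreal s \<le> t \<and> B \<in> sets borel}
      \<subseteq> Pow (space M)" for t
    by blast
  show "space (natural_filtration M X t) = space M" for t
    unfolding natural_filtration_def by (rule space_measure_of[OF sub])
  show "sets (natural_filtration M X t) \<subseteq> sets (natural_filtration M X u)" if "t \<le> u" for t u
    unfolding natural_filtration_def sets_measure_of[OF sub]
    using that by (intro sigma_sets_mono') (blast intro: order_trans)
qed

definition transition_kernel ::
    "(real \<Rightarrow> 'a \<Rightarrow> 's::topological_space) \<Rightarrow> ('s \<Rightarrow> 'a measure) \<Rightarrow> real \<Rightarrow> 's \<Rightarrow> 's measure" where
  "transition_kernel X P s z = distr (P z) borel (X s)"

text \<open>Only the measurable space underlying \<^term>\<open>M\<close> matters, not its measure.\<close>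

locale strong_markov_diffusion =
  fixes M :: "'a measure"
    and X :: "real \<Rightarrow> 'a \<Rightarrow> 's::topological_space"
    and P :: "'s \<Rightarrow> 'a measure"
  assumes prob_space_P: "prob_space (P z)"
    and sets_P: "sets (P z) = sets M"
    and measurable_X: "0 \<le> s \<Longrightarrow> X s \<in> M \<rightarrow>\<^sub>M borel"
    and continuous_X: "\<omega> \<in> space M \<Longrightarrow> continuous_on {0..} (\<lambda>s. X s \<omega>)"
    and start_X: "AE \<omega> in P z. X 0 \<omega> = z"
    and measurable_kernel: "0 \<le> s \<Longrightarrow> transition_kernel X P s \<in> borel \<rightarrow>\<^sub>M prob_algebra borel"
    and strong_markov:
      "stopping_time (natural_filtration M X) T \<Longrightarrow>
       A \<in> sets (filtration.pre_sigma (space M) (natural_filtration M X) T) \<Longrightarrow>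
       0 \<le> s \<Longrightarrow> B \<in> sets borel \<Longrightarrow>
       emeasure (P z) {\<omega> \<in> A. T \<omega> < \<infinity> \<and> X (enn2real (T \<omega>) + s) \<omega> \<in> B} =
       (\<integral>\<^sup>+ \<omega> \<in> {\<omega> \<in> A. T \<omega> < \<infinity>}.
          emeasure (transition_kernel X P s (X (enn2real (T \<omega>)) \<omega>)) B \<partial>P z)"

definition feller_process ::
    "(real \<Rightarrow> 'a \<Rightarrow> 's::topological_space) \<Rightarrow> ('s \<Rightarrow> 'a measure) \<Rightarrow> bool" where
  "feller_process X P \<longleftrightarrow>
     (\<forall>s\<ge>0. \<forall>f :: 's \<Rightarrow> real. continuous_on UNIV f \<and> bounded (range f) \<longrightarrow>
        continuous_on UNIV (\<lambda>z. \<integral>\<omega>. f (X s \<omega>) \<partial>P z))"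

section \<open>The equation and its processes\<close>

definition drift :: "real \<Rightarrow> real \<Rightarrow> real \<Rightarrow> real" where
  "drift \<nu> t x = indicator {0<..} t * t powr (- \<nu>) * sgn x"

definition sde_solution ::
    "real \<Rightarrow> real \<times> real \<Rightarrow> 'w measure \<Rightarrow> (real \<Rightarrow> 'w \<Rightarrow> real) \<Rightarrow> (real \<Rightarrow> 'w \<Rightarrow> real \<times> real) \<Rightarrow> bool" where
  "sde_solution \<nu> z W w Z \<longleftrightarrow>
     wiener_process W w \<and>
     (\<forall>s\<ge>0. Z s \<in> W \<rightarrow>\<^sub>M borel) \<and>
     (AE \<omega> in W. continuous_on {0..} (\<lambda>s. Z s \<omega>) \<and>
       (\<forall>s\<ge>0. fst (Z s \<omega>) = fst z + s \<and>
              snd (Z s \<omega>) = snd z + w s \<omega>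
                + (LINT r:{0..s}|lborel. drift \<nu> (fst (Z r \<omega>)) (snd (Z r \<omega>)))))"

definition path_law :: "'a measure \<Rightarrow> (real \<Rightarrow> 'a \<Rightarrow> 's::topological_space) \<Rightarrow> (real \<Rightarrow> 's) measure" where
  "path_law Q X = distr Q (Pi\<^sub>M {0..} (\<lambda>_. borel)) (\<lambda>\<omega>. \<lambda>s\<in>{0..}. X s \<omega>)"

text \<open>The type argument is the type of the sample points of the spaces carrying the Wiener
  processes: a quantifier over all probability spaces has to fix that type, so it is a
  parameter here, and results about L-processes are to be stated for an arbitrary one.

  No filtration is needed on these spaces. Under each measure of the family the process
  recovers the Wiener process as a functional of the trajectory, and the Markov property makes
  its increments independent of the past of the trajectory.\<close>

definition L_process ::
    "'w itself \<Rightarrow> real \<Rightarrow> 'a measure \<Rightarrow> (real \<Rightarrow> 'a \<Rightarrow> real \<times> real) \<Rightarrow>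
     (real \<times> real \<Rightarrow> 'a measure) \<Rightarrow> bool" where
  "L_process (_ :: 'w itself) \<nu> M X P \<longleftrightarrow>
     strong_markov_diffusion M X P \<and>
     (\<forall>z. \<exists>(W :: 'w measure) w Z. sde_solution \<nu> z W w Z \<and> path_law (P z) X = path_law W Z)"

end

theory Submission
  imports Defs
begin

text \<open>
  The drift has strength $t^{-\nu}$ with $\nu>1/2$, so over a short time $s$ it moves a path that
  stays on one side of zero by $s^{1-\nu}/(1-\nu)$, much more than the typical size $s^{1/2}$ of
  the noise. A path starting at time $0$ from a point $x>0$, however small, is therefore thrown
  upwards: if $|w_s|\le s^{1-\nu}$ for all $s\le\delta$, it never returns to zero before $\delta$
  and is at least $(1/(1-\nu)-1)\,\delta^{1-\nu}$ at time $\delta$ (\<open>escape_up\<close>). By symmetry a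
  path starting from $x<0$ is thrown downwards just as far.

  The event on which the noise obeys this bound has a probability that depends only on $\nu$ and
  $\delta$ and tends to one as $\delta\to0$ (\<open>power_envelope\<close>). It can thus be made at least
  $3/4$ for one fixed $\delta$, simultaneously for all starting points. For the continuous function
  obtained by clamping a multiple of the spatial coordinate to $[-1,1]$, with value $1$ where the
  upper paths arrive and $-1$ where the lower ones do, the expectation at time $\delta$ is then at
  least $1/2$ from every $(0,x)$ with $x>0$ and at most $-1/2$ from every $(0,x)$ with $x<0$
  (\<open>sde_solution_escapes\<close>). As a function of the starting point it is therefore discontinuous at
  the origin.
\<close>

section \<open>Small-time growth of the Wiener process\<close>

text \<open>Ottaviani's inequality. Split the event according to the first index at which the partial sums
  reach the level \<^term>\<open>2 * a\<close> in absolute value. What happens up to that index is independent of the remaining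
  increments, whose sum stays below \<^term>\<open>a\<close> in absolute value with probability at least \<^term>\<open>1 - p\<close>; when it
  does, the final sum is still at least \<^term>\<open>a\<close> in absolute value.\<close>

lemma (in prob_space) ottaviani:
  fixes X :: "nat \<Rightarrow> 'a \<Rightarrow> real"
  assumes indep: "indep_vars (\<lambda>_. borel) X {..<n}"
    and tail: "\<And>k. k \<le> n \<Longrightarrow> prob {\<omega> \<in> space M. a \<le> \<bar>\<Sum>i=k..<n. X i \<omega>\<bar>} \<le> p"
  shows "(1 - p) * prob {\<omega> \<in> space M. \<exists>k\<le>n. 2 * a \<le> \<bar>\<Sum>i<k. X i \<omega>\<bar>}
       \<le> prob {\<omega> \<in> space M. a \<le> \<bar>\<Sum>i<n. X i \<omega>\<bar>}"
proof -
  define S where "S k \<omega> = (\<Sum>i<k. X i \<omega>)" for k \<omega>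
  define A where "A k = {\<omega> \<in> space M. 2 * a \<le> \<bar>S k \<omega>\<bar> \<and> (\<forall>j<k. \<bar>S j \<omega>\<bar> < 2 * a)}" for k
  define C where "C k = {\<omega> \<in> space M. \<bar>\<Sum>i=k..<n. X i \<omega>\<bar> < a}" for k
  have X: "X i \<in> borel_measurable M" if "i < n" for i
    using indep that by (simp add: indep_vars_def)
  have S: "S k \<in> borel_measurable M" if "k \<le> n" for k
    unfolding S_def using that by (intro borel_measurable_sum X) auto
  have R [measurable]: "(\<lambda>\<omega>. \<Sum>i=k..<n. X i \<omega>) \<in> borel_measurable M" for k
    by (intro borel_measurable_sum X) auto
  have A: "A k \<in> events" if "k \<le> n" for k
  proof -
    have [measurable]: "S j \<in> borel_measurable M" if "j \<le> k" for j
      using that \<open>k \<le> n\<close> by (intro S) simp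
    show ?thesis unfolding A_def by measurable
  qed
  have C: "C k \<in> events" for k
    unfolding C_def by measurable
  (* Both factors are read off from blocks of coordinates with disjoint index sets. *)
  have AC: "prob (A k \<inter> C k) = prob (A k) * prob (C k)" if k: "k \<le> n" for k
  proof -
    define Y where "Y \<omega> = restrict (\<lambda>i. X i \<omega>) {..<k}" for \<omega>
    define Z where "Z \<omega> = restrict (\<lambda>i. X i \<omega>) {k..<n}" for \<omega>
    define PA :: "(nat \<Rightarrow> real) measure" where "PA = PiM {..<k} (\<lambda>_. borel)"
    define PB :: "(nat \<Rightarrow> real) measure" where "PB = PiM {k..<n} (\<lambda>_. borel)"
    define Ea where "Ea = {x \<in> space PA. 2 * a \<le> \<bar>\<Sum>i<k. x i\<bar> \<and> (\<forall>j<k. \<bar>\<Sum>i<j. x i\<bar> < 2 * a)}"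
    define Eb where "Eb = {x \<in> space PB. \<bar>\<Sum>i=k..<n. x i\<bar> < a}"
    have YZ: "indep_var PA Y PB Z"
      unfolding PA_def PB_def Y_def Z_def
      by (rule indep_var_restrict[OF indep]) (use k in auto)
    define F where "F j x = (\<Sum>i<j. x i)" for j and x :: "nat \<Rightarrow> real"
    define G where "G x = (\<Sum>i=k..<n. x i)" for x :: "nat \<Rightarrow> real"
    have [measurable]: "F j \<in> borel_measurable PA" if "j \<le> k" for j
      unfolding F_def PA_def using that
      by (intro borel_measurable_sum measurable_component_singleton) auto
    have [measurable]: "G \<in> borel_measurable PB"
      unfolding G_def PB_def by (intro borel_measurable_sum measurable_component_singleton)
    have "{x \<in> space PA. 2 * a \<le> \<bar>F k x\<bar> \<and> (\<forall>j<k. \<bar>F j x\<bar> < 2 * a)} \<in> sets PA"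
      by measurable
    then have Ea: "Ea \<in> sets PA" by (simp only: Ea_def F_def)
    have "{x \<in> space PB. \<bar>G x\<bar> < a} \<in> sets PB"
      by measurable
    then have Eb: "Eb \<in> sets PB" by (simp only: Eb_def G_def)
    have sp: "Y \<omega> \<in> space PA" "Z \<omega> \<in> space PB" for \<omega>
      by (auto simp: PA_def PB_def Y_def Z_def space_PiM)
    have sumY: "(\<Sum>i<j. Y \<omega> i) = S j \<omega>" if "j \<le> k" for j \<omega>
      unfolding S_def Y_def using that by (intro sum.cong) auto
    have sumZ: "(\<Sum>i=k..<n. Z \<omega> i) = (\<Sum>i=k..<n. X i \<omega>)" for \<omega>
      unfolding Z_def by (intro sum.cong) auto
    have eA: "Y -` Ea \<inter> space M = A k"
      using sp sumY by (auto simp: Ea_def A_def)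
    have eB: "Z -` Eb \<inter> space M = C k"
      using sp sumZ by (auto simp: Eb_def C_def)
    have "(\<lambda>x. (Y x, Z x)) -` (Ea \<times> Eb) \<inter> space M = A k \<inter> C k"
      using eA eB by auto
    with indep_varD[OF YZ Ea Eb] eA eB show ?thesis by simp
  qed
  have pC: "1 - p \<le> prob (C k)" if "k \<le> n" for k
  proof -
    have "C k = space M - {\<omega> \<in> space M. a \<le> \<bar>\<Sum>i=k..<n. X i \<omega>\<bar>}"
      by (auto simp: C_def)
    then have "prob (C k) = 1 - prob {\<omega> \<in> space M. a \<le> \<bar>\<Sum>i=k..<n. X i \<omega>\<bar>}"
      by (simp add: prob_compl)
    with tail[OF that] show ?thesis by simp
  qed
  have disj: "disjoint_family_on A {..n}"
    unfolding disjoint_family_on_def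
  proof (intro ballI impI)
    fix j k :: nat assume "j \<noteq> k"
    then consider "j < k" | "k < j" by linarith
    then show "A j \<inter> A k = {}" by cases (force simp: A_def)+
  qed
  have un: "{\<omega> \<in> space M. \<exists>k\<le>n. 2 * a \<le> \<bar>\<Sum>i<k. X i \<omega>\<bar>} = (\<Union>k\<le>n. A k)"
  proof (intro equalityI subsetI)
    fix \<omega> assume "\<omega> \<in> {\<omega> \<in> space M. \<exists>k\<le>n. 2 * a \<le> \<bar>\<Sum>i<k. X i \<omega>\<bar>}"
    then obtain k where k: "\<omega> \<in> space M" "k \<le> n" "2 * a \<le> \<bar>S k \<omega>\<bar>"
      by (auto simp: S_def)
    define m where "m = (LEAST k. 2 * a \<le> \<bar>S k \<omega>\<bar>)"
    have "2 * a \<le> \<bar>S m \<omega>\<bar>" "m \<le> k"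
      unfolding m_def by (rule LeastI[of "\<lambda>k. 2 * a \<le> \<bar>S k \<omega>\<bar>", OF k(3)],
        rule Least_le[of "\<lambda>k. 2 * a \<le> \<bar>S k \<omega>\<bar>", OF k(3)])
    moreover have "\<bar>S j \<omega>\<bar> < 2 * a" if "j < m" for j
      using not_less_Least[OF that[unfolded m_def]] by simp
    ultimately show "\<omega> \<in> (\<Union>k\<le>n. A k)"
      using k by (auto simp: A_def intro!: bexI[of _ m])
  qed (auto simp: A_def S_def)
  have "(1 - p) * prob (\<Union>k\<le>n. A k) = (\<Sum>k\<le>n. (1 - p) * prob (A k))"
    using A by (subst finite_measure_finite_Union[OF _ _ disj]) (auto simp: sum_distrib_left)
  also have "\<dots> \<le> (\<Sum>k\<le>n. prob (A k \<inter> C k))"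
    using pC by (intro sum_mono) (simp add: AC mult.commute[of "prob (A _)"] mult_right_mono)
  also have "\<dots> = prob (\<Union>k\<le>n. A k \<inter> C k)"
  proof (rule finite_measure_finite_Union[symmetric])
    show "disjoint_family_on (\<lambda>k. A k \<inter> C k) {..n}"
      using disj unfolding disjoint_family_on_def by blast
  qed (use A C in auto)
  also have "\<dots> \<le> prob {\<omega> \<in> space M. a \<le> \<bar>\<Sum>i<n. X i \<omega>\<bar>}"
  proof (rule finite_measure_mono)
    show "(\<Union>k\<le>n. A k \<inter> C k) \<subseteq> {\<omega> \<in> space M. a \<le> \<bar>\<Sum>i<n. X i \<omega>\<bar>}"
    proof safe
      fix k \<omega> assume k: "k \<le> n" "\<omega> \<in> A k" "\<omega> \<in> C k"
      have "(\<Sum>i<n. X i \<omega>) = S k \<omega> + (\<Sum>i=k..<n. X i \<omega>)"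
        using k sum.atLeastLessThan_concat[of 0 k n "\<lambda>i. X i \<omega>"]
        by (simp add: S_def lessThan_atLeast0)
      then show "a \<le> \<bar>\<Sum>i<n. X i \<omega>\<bar>"
        using k by (auto simp: A_def C_def)
    qed (auto simp: A_def)
    show "{\<omega> \<in> space M. a \<le> \<bar>\<Sum>i<n. X i \<omega>\<bar>} \<in> events"
      using R[of 0] by (simp add: lessThan_atLeast0)
  qed
  finally show ?thesis unfolding un .
qed

context wiener_process
begin

lemma increment_tail:
  assumes "0 \<le> s" "s \<le> t" "0 < a"
  shows "prob {\<omega> \<in> space W. a \<le> \<bar>w t \<omega> - w s \<omega>\<bar>} \<le> (t - s) / a\<^sup>2"
proof (cases "s = t")
  case True
  with assms show ?thesis by simp
next
  case False
  with assms have st: "0 < sqrt (t - s)" "s < t" by auto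
  define Y where "Y \<omega> = w t \<omega> - w s \<omega>" for \<omega>
  have D: "distributed W lborel Y (normal_density 0 (sqrt (t - s)))"
    unfolding Y_def using normal_increments assms st by blast
  have [measurable]: "Y \<in> borel_measurable W"
    unfolding Y_def using assms by (intro borel_measurable_diff measurable_w) auto
  have E: "expectation Y = 0" and V: "variance Y = t - s"
    using normal_distributed_expectation[OF st(1) D] normal_distributed_variance[OF st(1) D] st
    by simp_all
  have "integrable W (\<lambda>\<omega>. (Y \<omega>)\<^sup>2)"
    using integrable_normal_moment[OF st(1), of 0 2]
    by (subst distributed_integrable[OF D, symmetric]) auto
  from Chebyshev_inequality[OF _ this \<open>0 < a\<close>]
  have "prob {\<omega> \<in> space W. a \<le> \<bar>Y \<omega> - expectation Y\<bar>} \<le> (t - s) / a\<^sup>2"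
    unfolding V by simp
  then show ?thesis unfolding E by (simp add: Y_def)
qed

text \<open>Chebyshev's inequality gives the tail bound \<^term>\<open>T / a\<^sup>2\<close> for every increment inside the interval.
  If it is at most one half, Ottaviani's inequality costs only a factor of two, and otherwise the
  claimed bound exceeds one. The bound does not depend on the mesh, which lets the mesh tend to zero.\<close>

lemma grid_maximum_tail:
  assumes "0 < T" "0 < a"
  shows "prob {\<omega> \<in> space W. \<exists>k\<le>n. 2 * a \<le> \<bar>w (real k * (T / real n)) \<omega> - w 0 \<omega>\<bar>} \<le> 2 * T / a\<^sup>2"
proof (cases "n = 0 \<or> 1/2 < T / a\<^sup>2")
  case True
  then show ?thesis
  proof
    assume "n = 0" with assms show ?thesis by simp
  next
    assume "1/2 < T / a\<^sup>2"
    then have "1 \<le> 2 * T / a\<^sup>2" by (simp add: field_simps)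
    then show ?thesis using prob_le_1 order_trans by blast
  qed
next
  case False
  then have n: "0 < n" and p: "T / a\<^sup>2 \<le> 1/2" by auto
  define \<tau> where "\<tau> k = real k * (T / real n)" for k
  define D where "D i \<omega> = w (\<tau> (Suc i)) \<omega> - w (\<tau> i) \<omega>" for i \<omega>
  have \<tau>0: "\<tau> 0 = 0" and \<tau>n: "\<tau> n = T" and \<tau>nn: "0 \<le> \<tau> k" for k
    using n assms by (auto simp: \<tau>_def)
  have \<tau>le: "\<tau> k \<le> T" if "k \<le> n" for k
    using that n assms by (simp add: \<tau>_def field_simps)
  have indep: "indep_vars (\<lambda>_. borel) D {..<n}"
    unfolding D_def using n assms
    by (intro indep_increments) (auto simp: \<tau>_def divide_strict_right_mono)
  have sumD: "(\<Sum>i=k..<m. D i \<omega>) = w (\<tau> m) \<omega> - w (\<tau> k) \<omega>" if "k \<le> m" for k m \<omega>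
    unfolding D_def by (rule sum_Suc_diff'[OF that])
  have sumD0: "(\<Sum>i<m. D i \<omega>) = w (\<tau> m) \<omega> - w 0 \<omega>" for m \<omega>
    using sumD[of 0 m \<omega>] by (simp add: lessThan_atLeast0 \<tau>0)
  have tail: "prob {\<omega> \<in> space W. a \<le> \<bar>\<Sum>i=k..<n. D i \<omega>\<bar>} \<le> T / a\<^sup>2" if "k \<le> n" for k
  proof -
    have "prob {\<omega> \<in> space W. a \<le> \<bar>\<Sum>i=k..<n. D i \<omega>\<bar>} \<le> (T - \<tau> k) / a\<^sup>2"
      unfolding sumD[OF that] \<tau>n by (rule increment_tail) (use \<tau>nn \<tau>le that assms in auto)
    also have "\<dots> \<le> T / a\<^sup>2" using \<tau>nn[of k] by (simp add: divide_right_mono)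
    finally show ?thesis .
  qed
  let ?q = "prob {\<omega> \<in> space W. \<exists>k\<le>n. 2 * a \<le> \<bar>w (\<tau> k) \<omega> - w 0 \<omega>\<bar>}"
  have "(1/2) * ?q \<le> (1 - T / a\<^sup>2) * ?q"
    using p by (intro mult_right_mono) auto
  also have "\<dots> \<le> prob {\<omega> \<in> space W. a \<le> \<bar>w T \<omega> - w 0 \<omega>\<bar>}"
    using ottaviani[OF indep tail] unfolding sumD0 \<tau>n by simp
  also have "\<dots> \<le> T / a\<^sup>2" using increment_tail[of 0 T a] assms by simp
  finally have "?q \<le> 2 * (T / a\<^sup>2)" by linarith
  then show ?thesis by (simp only: \<tau>_def times_divide_eq_right)
qed

text \<open>Dyadic grids are nested, so the bounds on the grids pass to the union of the exceptional events;
  off that union, continuity of the path extends the bound from dyadic times to all times. Stating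
  the conclusion through an exceptional event avoids the measurability of an uncountable supremum.\<close>

lemma running_maximum_tail:
  assumes "0 < T" "0 < a"
  obtains B where "B \<in> events" "prob B \<le> 2 * T / a\<^sup>2"
    "AE \<omega> in W. \<omega> \<notin> B \<longrightarrow> (\<forall>s\<in>{0..T}. \<bar>w s \<omega>\<bar> \<le> 2 * a)"
proof -
  define \<tau> where "\<tau> j k = real k * (T / real (2 ^ j))" for j k :: nat
  define E where "E j = {\<omega> \<in> space W. \<exists>k\<le>2 ^ j. 2 * a \<le> \<bar>w (\<tau> j k) \<omega> - w 0 \<omega>\<bar>}" for j :: nat
  have \<tau>nn: "0 \<le> \<tau> j k" for j k
    using assms by (simp add: \<tau>_def)
  have m [measurable]: "w (\<tau> j k) \<in> borel_measurable W" "w 0 \<in> borel_measurable W" for j k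
    using \<tau>nn by (auto intro: measurable_w)
  have E: "E j \<in> events" for j
    unfolding E_def by measurable
  have "incseq E"
  proof (rule incseq_SucI, rule subsetI)
    fix j \<omega> assume "\<omega> \<in> E j"
    then obtain k where "\<omega> \<in> space W" "k \<le> 2 ^ j" "2 * a \<le> \<bar>w (\<tau> j k) \<omega> - w 0 \<omega>\<bar>"
      by (auto simp: E_def)
    moreover have "\<tau> (Suc j) (2 * k) = \<tau> j k"
      by (simp add: \<tau>_def)
    ultimately show "\<omega> \<in> E (Suc j)"
      by (auto simp: E_def intro!: exI[of _ "2 * k"])
  qed
  then have "(\<lambda>j. prob (E j)) \<longlonglongrightarrow> prob (\<Union>j. E j)"
    using E by (intro finite_Lim_measure_incseq) auto
  moreover have "prob (E j) \<le> 2 * T / a\<^sup>2" for j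
    unfolding E_def \<tau>_def by (rule grid_maximum_tail[OF assms])
  ultimately have "prob (\<Union>j. E j) \<le> 2 * T / a\<^sup>2"
    by (intro LIMSEQ_le_const2) auto
  moreover have "AE \<omega> in W. \<omega> \<notin> (\<Union>j. E j) \<longrightarrow> (\<forall>s\<in>{0..T}. \<bar>w s \<omega>\<bar> \<le> 2 * a)"
    using start_w continuous_w AE_space
  proof eventually_elim
    case (elim \<omega>)
    show ?case
    proof (intro impI ballI)
      fix s assume notE: "\<omega> \<notin> (\<Union>j. E j)" and s: "s \<in> {0..T}"
      (* The largest grid point of level j that is not beyond s. *)
      define k where "k j = nat \<lfloor>s * 2 ^ j / T\<rfloor>" for j :: nat
      have k: "real (k j) \<le> s * 2 ^ j / T" "s * 2 ^ j / T - 1 < real (k j)" for j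
        using s assms by (auto simp: k_def of_nat_nat)
      have "\<tau> j (k j) \<le> s" for j
        using k(1)[of j] assms by (simp add: \<tau>_def field_simps)
      moreover have "s - T / 2 ^ j \<le> \<tau> j (k j)" for j
      proof -
        have "s - T / 2 ^ j = (s * 2 ^ j / T - 1) * (T / 2 ^ j)"
          using assms by (simp add: left_diff_distrib diff_divide_distrib)
        also have "\<dots> \<le> real (k j) * (T / 2 ^ j)"
          using k(2)[of j] assms by (intro mult_right_mono) auto
        finally show ?thesis by (simp add: \<tau>_def)
      qed
      moreover have "(\<lambda>j. s - T / 2 ^ j) \<longlonglongrightarrow> s"
      proof -
        have "(\<lambda>j. s - T * (1 / 2) ^ j) \<longlonglongrightarrow> s - T * 0"
          by (intro tendsto_intros LIMSEQ_realpow_zero) auto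
        then show ?thesis by (simp add: power_one_over)
      qed
      ultimately have lim: "(\<lambda>j. \<tau> j (k j)) \<longlonglongrightarrow> s"
        by - (rule tendsto_sandwich[of "\<lambda>j. s - T / 2 ^ j" _ _ "\<lambda>_. s"], auto)
      have "(\<lambda>j. w (\<tau> j (k j)) \<omega>) \<longlonglongrightarrow> w s \<omega>"
        by (rule continuous_on_tendsto_compose[OF elim(2) lim]) (use s \<tau>nn in auto)
      then have wlim: "(\<lambda>j. \<bar>w (\<tau> j (k j)) \<omega>\<bar>) \<longlonglongrightarrow> \<bar>w s \<omega>\<bar>"
        by (rule tendsto_rabs)
      have "\<bar>w (\<tau> j (k j)) \<omega>\<bar> \<le> 2 * a" for j
      proof -
        have "s * 2 ^ j / T \<le> 2 ^ j"
          using s assms by (simp add: pos_divide_le_eq mult.commute[of s] mult_left_mono)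
        with k(1)[of j] have "real (k j) \<le> 2 ^ j" by (rule order_trans)
        then have "k j \<le> 2 ^ j" by simp
        moreover have "\<omega> \<notin> E j" using notE by blast
        ultimately have "\<not> 2 * a \<le> \<bar>w (\<tau> j (k j)) \<omega> - w 0 \<omega>\<bar>"
          using elim(3) unfolding E_def by blast
        with elim(1) show ?thesis by simp
      qed
      with wlim show "\<bar>w s \<omega>\<bar> \<le> 2 * a"
        by (intro LIMSEQ_le_const2) auto
    qed
  qed
  ultimately show ?thesis using E by (intro that[of "\<Union>j. E j"]) auto
qed

text \<open>The running maximum is compared with the envelope on each of the dyadic blocks
  $[\delta/2^{n+1},\delta/2^n]$. On one of them the probability of failure is of order
  $(\delta/2^n)^{1-2\beta}$, by the preceding bound applied with $2a=(\delta/2^{n+1})^\beta$.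
  Because $\beta<1/2$ these probabilities form a geometric series, whose sum tends to zero with
  $\delta$ and depends on nothing but $\beta$ and $\delta$.\<close>

lemma power_envelope:
  assumes "0 < \<beta>" "\<beta> < 1/2" "0 < \<delta>"
  obtains B where "B \<in> events"
    "prob B \<le> 16 * (\<delta> / 2) powr (1 - 2 * \<beta>) / (1 - (1/2) powr (1 - 2 * \<beta>))"
    "AE \<omega> in W. \<omega> \<notin> B \<longrightarrow> (\<forall>s\<in>{0..\<delta>}. \<bar>w s \<omega>\<bar> \<le> s powr \<beta>)"
proof -
  define p where "p = 1 - 2 * \<beta>"
  have p: "0 < p" using assms by (simp add: p_def)
  (* The left end of the n-th dyadic block; the right end is twice as large. *)
  define u where "u n = \<delta> / 2 ^ Suc n" for n :: nat
  have u: "0 < u n" for n using assms by (simp add: u_def)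
  have "\<exists>B. B \<in> events \<and> prob B \<le> 16 * u n powr p \<and>
      (AE \<omega> in W. \<omega> \<notin> B \<longrightarrow> (\<forall>s\<in>{0..2 * u n}. \<bar>w s \<omega>\<bar> \<le> u n powr \<beta>))" for n
  proof -
    obtain B where B: "B \<in> events" "prob B \<le> 2 * (2 * u n) / (u n powr \<beta> / 2)\<^sup>2"
      "AE \<omega> in W. \<omega> \<notin> B \<longrightarrow> (\<forall>s\<in>{0..2 * u n}. \<bar>w s \<omega>\<bar> \<le> 2 * (u n powr \<beta> / 2))"
      by (rule running_maximum_tail[of "2 * u n" "u n powr \<beta> / 2"]) (use u[of n] in auto)
    have "(u n powr \<beta>)\<^sup>2 = u n powr (2 * \<beta>)"
      using u[of n] by (simp add: powr_power)
    then have "2 * (2 * u n) / (u n powr \<beta> / 2)\<^sup>2 = 16 * (u n powr 1 / u n powr (2 * \<beta>))"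
      using u[of n] by (simp add: power_divide)
    also have "\<dots> = 16 * u n powr p"
      unfolding p_def powr_diff by simp
    finally have "2 * (2 * u n) / (u n powr \<beta> / 2)\<^sup>2 = 16 * u n powr p" .
    moreover have "2 * (u n powr \<beta> / 2) = u n powr \<beta>" by simp
    ultimately show ?thesis using B by (intro exI[of _ B] conjI) simp_all
  qed
  then have "\<forall>n. \<exists>B. B \<in> events \<and> prob B \<le> 16 * u n powr p \<and>
      (AE \<omega> in W. \<omega> \<notin> B \<longrightarrow> (\<forall>s\<in>{0..2 * u n}. \<bar>w s \<omega>\<bar> \<le> u n powr \<beta>))"
    by blast
  from choice[OF this] obtain B where B: "\<And>n. B n \<in> events" "\<And>n. prob (B n) \<le> 16 * u n powr p"
      "\<And>n. AE \<omega> in W. \<omega> \<notin> B n \<longrightarrow> (\<forall>s\<in>{0..2 * u n}. \<bar>w s \<omega>\<bar> \<le> u n powr \<beta>)"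
    by blast
  define q :: real where "q = (1/2) powr p"
  have q: "0 < q" "q < 1"
    using p powr_less_mono2[of p "1/2" 1] by (simp_all add: q_def)
  have uq: "16 * u n powr p = 16 * (\<delta> / 2) powr p * q ^ n" for n
  proof -
    have "u n = (\<delta> / 2) * (1/2) ^ n" by (simp add: u_def power_one_over)
    moreover have "((1/2) ^ n) powr p = q ^ n"
      unfolding q_def by (simp add: powr_power powr_realpow[symmetric] powr_powr mult.commute)
    ultimately show ?thesis
      by (simp only: powr_mult mult.assoc)
  qed
  have sums: "(\<lambda>n. 16 * (\<delta> / 2) powr p * q ^ n) sums (16 * (\<delta> / 2) powr p * (1 / (1 - q)))"
    using q by (intro sums_mult geometric_sums) auto
  have le: "prob (B n) \<le> 16 * (\<delta> / 2) powr p * q ^ n" for n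
    using B(2)[of n] uq by simp
  have summ: "summable (\<lambda>n. prob (B n))"
    using le by (intro summable_comparison_test[OF _ sums_summable[OF sums]]) auto
  have "prob (\<Union>n. B n) \<le> (\<Sum>n. prob (B n))"
    using B summ by (intro finite_measure_subadditive_countably) auto
  also have "\<dots> \<le> 16 * (\<delta> / 2) powr p / (1 - q)"
    using suminf_le[OF le summ sums_summable[OF sums]] sums_unique[OF sums] by simp
  finally have prob: "prob (\<Union>n. B n) \<le> 16 * (\<delta> / 2) powr p / (1 - q)" .
  have "AE \<omega> in W. \<forall>n. \<omega> \<notin> B n \<longrightarrow> (\<forall>s\<in>{0..2 * u n}. \<bar>w s \<omega>\<bar> \<le> u n powr \<beta>)"
    using B(3) by (simp add: AE_all_countable)
  with start_w have "AE \<omega> in W. \<omega> \<notin> (\<Union>n. B n) \<longrightarrow> (\<forall>s\<in>{0..\<delta>}. \<bar>w s \<omega>\<bar> \<le> s powr \<beta>)"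
  proof eventually_elim
    case (elim \<omega>)
    show ?case
    proof (intro impI ballI)
      fix s assume notB: "\<omega> \<notin> (\<Union>n. B n)" and s: "s \<in> {0..\<delta>}"
      show "\<bar>w s \<omega>\<bar> \<le> s powr \<beta>"
      proof (cases "s = 0")
        case True with elim show ?thesis by simp
      next
        case False
        have "(\<lambda>n. \<delta> * (1/2) ^ n) \<longlonglongrightarrow> \<delta> * 0"
          by (intro tendsto_intros LIMSEQ_realpow_zero) auto
        then have "\<forall>\<^sub>F n in sequentially. \<delta> * (1/2) ^ n < s"
          using False s by (intro order_tendstoD(2)[of _ "\<delta> * 0"]) auto
        then obtain m where m: "\<delta> * (1/2) ^ m < s"
          by (auto simp: eventually_sequentially)
        (* The first dyadic fraction of \<delta> below s is the left end of a block that contains s. *)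
        define n where "n = (LEAST m. \<delta> * (1/2) ^ m < s)"
        have n: "\<delta> * (1/2) ^ n < s" unfolding n_def using m by (rule LeastI)
        have "n \<noteq> 0" using n s by (intro notI) auto
        then obtain k where k: "n = Suc k" by (cases n) auto
        have "\<not> \<delta> * (1/2) ^ k < s"
          using not_less_Least[of k "\<lambda>m. \<delta> * (1/2) ^ m < s"] k n_def by simp
        then have "s \<in> {0..2 * u k}" "u k \<le> s"
          using n s by (auto simp: k u_def power_one_over)
        with elim notB have "\<bar>w s \<omega>\<bar> \<le> u k powr \<beta>" by auto
        also have "\<dots> \<le> s powr \<beta>"
          using \<open>u k \<le> s\<close> u[of k] assms by (intro powr_mono2) auto
        finally show ?thesis .
      qed
    qed
  qed
  with prob B(1) show ?thesis
    by (intro that[of "\<Union>n. B n"]) (auto simp: p_def q_def)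
qed

end

section \<open>Paths driven away from zero\<close>

lemma integral_powr_from_0:
  fixes s \<nu> :: real
  assumes "\<nu> < 1" "0 \<le> s"
  shows "(LINT r:{0..s}|lborel. r powr (- \<nu>)) = s powr (1 - \<nu>) / (1 - \<nu>)"
proof -
  have I: "((\<lambda>r. r powr (- \<nu>)) has_integral s powr (1 - \<nu>) / (1 - \<nu>)) {0..s}"
    using has_integral_powr_from_0[of "- \<nu>" s] assms by simp
  then have "set_integrable lebesgue {0..s} (\<lambda>r. r powr (- \<nu>))"
    by (intro nonnegative_absolutely_integrable_1) (auto simp: integrable_on_def)
  from set_lebesgue_integral_eq_integral(2)[OF this] I
  have "(LINT r:{0..s}|lebesgue. r powr (- \<nu>)) = s powr (1 - \<nu>) / (1 - \<nu>)"
    by (simp add: integral_unique)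
  moreover have "(LINT r:{0..s}|lebesgue. r powr (- \<nu>)) = (LINT r:{0..s}|lborel. r powr (- \<nu>))"
    unfolding set_lebesgue_integral_def by (rule integral_completion) measurable
  ultimately show ?thesis by simp
qed

text \<open>The value at the endpoint is left free because the lemma is applied up to a hypothetical first
  zero of the path; a single point does not affect the integral.\<close>

lemma integral_drift_positive:
  assumes "\<nu> < 1" "0 \<le> s" and pos: "\<And>r. 0 \<le> r \<Longrightarrow> r < s \<Longrightarrow> 0 < y r"
  shows "(LINT r:{0..s}|lborel. drift \<nu> r (y r)) = s powr (1 - \<nu>) / (1 - \<nu>)"
proof -
  have "(LINT r:{0..s}|lborel. drift \<nu> r (y r)) = 
      (LINT r:{0..s}|lborel. (r powr (- \<nu>)) * (if r = s then sgn (y s) else 1))"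
    unfolding set_lebesgue_integral_def
    using pos by (intro Bochner_Integration.integral_cong) (auto simp: drift_def indicator_def)
  also have "\<dots> = (LINT r:{0..s}|lborel. r powr (- \<nu>))"
    unfolding set_lebesgue_integral_def
  proof (rule integral_cong_AE)
    show "AE r in lborel. indicator {0..s} r *\<^sub>R (r powr (- \<nu>) * (if r = s then sgn (y s) else 1))
        = indicator {0..s} r *\<^sub>R r powr (- \<nu>)"
      using AE_lborel_singleton[of s] by eventually_elim simp
  qed measurable
  finally show ?thesis using integral_powr_from_0 assms by simp
qed

text \<open>As long as the path is positive, the drift contributes $s^{1-\nu}/(1-\nu)$, which dominates the
  noise, bounded by $s^{1-\nu}$. Hence at a first zero the path would be at least its positive
  starting value. So there is no zero, and the resulting lower bound does not involve the starting
  value.\<close>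

lemma escape_up:
  assumes \<nu>: "0 < \<nu>" "\<nu> < 1" and "0 \<le> \<delta>" "0 < x"
    and cont: "continuous_on {0..} y"
    and v: "\<And>s. s \<in> {0..\<delta>} \<Longrightarrow> \<bar>v s\<bar> \<le> s powr (1 - \<nu>)"
    and y: "\<And>s. 0 \<le> s \<Longrightarrow> y s = x + v s + (LINT r:{0..s}|lborel. drift \<nu> r (y r))"
  shows "(1 / (1 - \<nu>) - 1) * \<delta> powr (1 - \<nu>) \<le> y \<delta>"
proof -
  have lower: "x + (1 / (1 - \<nu>) - 1) * s powr (1 - \<nu>) \<le> y s"
    if "s \<in> {0..\<delta>}" "\<And>r. 0 \<le> r \<Longrightarrow> r < s \<Longrightarrow> 0 < y r" for s
    using y[of s] v[of s] integral_drift_positive[of \<nu> s y] that \<nu> by (simp add: algebra_simps)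
  have coef: "0 \<le> (1 / (1 - \<nu>) - 1) * s powr (1 - \<nu>)" for s
    using \<nu> by (simp add: field_simps)
  have pos: "0 < y s" if s: "s \<in> {0..\<delta>}" for s
  proof (rule ccontr)
    assume neg: "\<not> 0 < y s"
    define K where "K = {0..\<delta>} \<inter> y -` {..0}"
    have "closed K" unfolding K_def
      using cont by (intro continuous_closed_preimage) (auto intro: continuous_on_subset)
    then have "compact K" unfolding K_def
      by (auto simp: compact_eq_bounded_closed intro: bounded_subset[of "{0..\<delta>}"])
    moreover have "K \<noteq> {}" using neg s by (auto simp: K_def)
    ultimately obtain \<sigma> where \<sigma>: "\<sigma> \<in> K" "\<And>r. r \<in> K \<Longrightarrow> \<sigma> \<le> r"
      using compact_attains_inf by metis
    have "x + (1 / (1 - \<nu>) - 1) * \<sigma> powr (1 - \<nu>) \<le> y \<sigma>"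
    proof (rule lower)
      show "0 < y r" if "0 \<le> r" "r < \<sigma>" for r
        using \<sigma>(2)[of r] that \<sigma>(1) by (force simp: K_def)
    qed (use \<sigma>(1) in \<open>simp add: K_def\<close>)
    with \<sigma>(1) coef[of \<sigma>] \<open>0 < x\<close> show False by (auto simp: K_def)
  qed
  from lower[of \<delta>] pos \<open>0 \<le> \<delta>\<close> \<open>0 < x\<close> show ?thesis by simp
qed

section \<open>Failure of the Feller property\<close>

lemma drift_mult_sign:
  assumes "\<sigma> \<in> {1, - 1}"
  shows "drift \<nu> t (\<sigma> * x) = \<sigma> * drift \<nu> t x"
  using assms by (auto simp: drift_def sgn_minus)

text \<open>The factor $\sigma$ treats starting points on both sides of zero at once, since the drift is odd
  in its spatial argument. What matters is that neither the level reached at time $\delta$ nor the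
  bound on the exceptional probability depends on \<^term>\<open>x\<close> or on the probability space.\<close>

lemma sde_solution_escapes:
  assumes \<nu>: "1/2 < \<nu>" "\<nu> < 1" and "0 < \<delta>" and \<sigma>: "\<sigma> \<in> {1, - 1}" "0 < \<sigma> * x"
    and sol: "sde_solution \<nu> (0, x) W w Z"
  obtains B where "B \<in> sets W"
    "measure W B \<le> 16 * (\<delta> / 2) powr (2 * \<nu> - 1) / (1 - (1/2) powr (2 * \<nu> - 1))"
    "AE \<omega> in W. \<omega> \<notin> B \<longrightarrow> (1 / (1 - \<nu>) - 1) * \<delta> powr (1 - \<nu>) \<le> \<sigma> * snd (Z \<delta> \<omega>)"
proof -
  interpret wiener_process W w using sol by (simp add: sde_solution_def)
  have exponent: "1 - 2 * (1 - \<nu>) = 2 * \<nu> - 1" by simp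
  obtain B where B: "B \<in> events"
      "prob B \<le> 16 * (\<delta> / 2) powr (2 * \<nu> - 1) / (1 - (1/2) powr (2 * \<nu> - 1))"
      "AE \<omega> in W. \<omega> \<notin> B \<longrightarrow> (\<forall>s\<in>{0..\<delta>}. \<bar>w s \<omega>\<bar> \<le> s powr (1 - \<nu>))"
    using power_envelope[of "1 - \<nu>" \<delta>, unfolded exponent] \<nu> \<open>0 < \<delta>\<close> by auto
  have "AE \<omega> in W. continuous_on {0..} (\<lambda>s. Z s \<omega>) \<and>
       (\<forall>s\<ge>0. fst (Z s \<omega>) = s \<and> snd (Z s \<omega>) = x + w s \<omega>
                + (LINT r:{0..s}|lborel. drift \<nu> (fst (Z r \<omega>)) (snd (Z r \<omega>))))"
    using sol by (simp add: sde_solution_def)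
  with B(3) have "AE \<omega> in W. \<omega> \<notin> B \<longrightarrow>
      (1 / (1 - \<nu>) - 1) * \<delta> powr (1 - \<nu>) \<le> \<sigma> * snd (Z \<delta> \<omega>)"
  proof eventually_elim
    case (elim \<omega>)
    show ?case
    proof
      assume "\<omega> \<notin> B"
      show "(1 / (1 - \<nu>) - 1) * \<delta> powr (1 - \<nu>) \<le> \<sigma> * snd (Z \<delta> \<omega>)"
      proof (rule escape_up[where x = "\<sigma> * x" and v = "\<lambda>s. \<sigma> * w s \<omega>"])
        show "continuous_on {0..} (\<lambda>s. \<sigma> * snd (Z s \<omega>))"
          using elim(2) by (intro continuous_intros) auto
        show "\<bar>\<sigma> * w s \<omega>\<bar> \<le> s powr (1 - \<nu>)" if "s \<in> {0..\<delta>}" for s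
          using elim(1) \<open>\<omega> \<notin> B\<close> that \<sigma>(1) by (auto simp: abs_mult)
        show "\<sigma> * snd (Z s \<omega>) = \<sigma> * x + \<sigma> * w s \<omega>
            + (LINT r:{0..s}|lborel. drift \<nu> r (\<sigma> * snd (Z r \<omega>)))" if "0 \<le> s" for s
        proof -
          have "(LINT r:{0..s}|lborel. drift \<nu> r (\<sigma> * snd (Z r \<omega>)))
              = (LINT r:{0..s}|lborel. \<sigma> * drift \<nu> (fst (Z r \<omega>)) (snd (Z r \<omega>)))"
            unfolding set_lebesgue_integral_def drift_mult_sign[OF \<sigma>(1)]
            by (rule Bochner_Integration.integral_cong[OF refl])
               (use elim(2) in \<open>simp add: indicator_def\<close>)
          then show ?thesis
            using elim(2) that by (simp add: distrib_left)
        qed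
      qed (use \<nu> \<sigma> \<open>0 < \<delta>\<close> in auto)
    qed
  qed
  with B show ?thesis using that by blast
qed

text \<open>The expectation of a function of the state at one time is determined by the path law, so it can
  be computed on the space that carries the Wiener process.\<close>

lemma expectation_path_law:
  fixes f :: "'s::topological_space \<Rightarrow> real"
  assumes X: "\<And>s. 0 \<le> s \<Longrightarrow> X s \<in> Q \<rightarrow>\<^sub>M borel" and f: "f \<in> borel_measurable borel" and "0 \<le> s"
  shows "(\<integral>\<omega>. f (X s \<omega>) \<partial>Q) = (\<integral>x. f (x s) \<partial>path_law Q X)"
proof -
  have "(\<lambda>\<omega>. \<lambda>s\<in>{0..}. X s \<omega>) \<in> Q \<rightarrow>\<^sub>M Pi\<^sub>M {0..} (\<lambda>_. borel)"
    using X by (intro measurable_restrict) auto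
  moreover have "(\<lambda>x. f (x s)) \<in> borel_measurable (Pi\<^sub>M {0..} (\<lambda>_. borel))"
    using \<open>0 \<le> s\<close> by (intro measurable_compose[OF _ f] measurable_component_singleton) simp
  ultimately show ?thesis
    using \<open>0 \<le> s\<close> unfolding path_law_def by (simp add: integral_distr)
qed

lemma (in prob_space) expectation_lower_bound_off_event:
  fixes f :: "'a \<Rightarrow> real"
  assumes f: "f \<in> borel_measurable M" and bound: "\<And>\<omega>. \<bar>f \<omega>\<bar> \<le> 1"
    and B: "B \<in> events" and off: "AE \<omega> in M. \<omega> \<notin> B \<longrightarrow> 1 \<le> f \<omega>"
  shows "1 - 2 * prob B \<le> expectation f"
proof -
  have int_B: "integrable M (indicator B :: 'a \<Rightarrow> real)"
    using B by (intro integrable_real_indicator) (auto simp: less_top[symmetric])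
  then have "1 - 2 * prob B = expectation (\<lambda>\<omega>. 1 - 2 * indicator B \<omega>)"
    using B by (subst Bochner_Integration.integral_diff) (auto simp: prob_space)
  also have "\<dots> \<le> expectation f"
  proof (rule integral_mono_AE)
    show "integrable M (\<lambda>\<omega>. 1 - 2 * indicator B \<omega> :: real)"
      using int_B by (intro Bochner_Integration.integrable_diff integrable_mult_right) auto
    show "integrable M f"
      using f bound by (intro integrable_const_bound[where B = 1]) auto
    show "AE \<omega> in M. 1 - 2 * indicator B \<omega> \<le> f \<omega>"
      using off
    proof eventually_elim
      case (elim \<omega>)
      show ?case using elim bound[of \<omega>] by (cases "\<omega> \<in> B") auto
    qed
  qed
  finally show ?thesis .
qed

theorem corollary6:
  fixes \<nu> :: real
    and M :: "'a measure"
    and X :: "real \<Rightarrow> 'a \<Rightarrow> real \<times> real"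
    and P :: "real \<times> real \<Rightarrow> 'a measure"
  assumes "1/2 < \<nu>" and "\<nu> < 1"
    and "L_process TYPE('w) \<nu> M X P"
  shows "\<not> feller_process X P"
proof
  assume feller: "feller_process X P"
  interpret strong_markov_diffusion M X P
    using assms(3) by (simp add: L_process_def)
  define p where "p = 2 * \<nu> - 1"
  have p: "0 < p" using assms(1) by (simp add: p_def)
  (* The time is chosen to make the bound on the exceptional probability equal to 1/4. *)
  define K where "K = (1 - (1/2) powr p) / 64"
  have K: "0 < K" using powr_less_mono2[of p "1/2" 1] p by (simp add: K_def)
  define \<delta> where "\<delta> = 2 * K powr (1 / p)"
  have \<delta>: "0 < \<delta>" using K by (simp add: \<delta>_def)
  have "(\<delta> / 2) powr p = K"
    using K p by (simp add: \<delta>_def powr_powr)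
  then have small: "16 * (\<delta> / 2) powr p / (1 - (1/2) powr p) = 1/4"
    using K p by (simp add: K_def)
  define \<eta> where "\<eta> = (1 / (1 - \<nu>) - 1) * \<delta> powr (1 - \<nu>)"
  have \<eta>: "0 < \<eta>"
    using assms(1,2) \<delta> by (simp add: \<eta>_def field_simps)
  (* A continuous version of the sign, equal to it at distance eta or more from zero. *)
  define f :: "real \<times> real \<Rightarrow> real" where "f z = max (- 1) (min 1 (snd z / \<eta>))" for z
  have f_cont: "continuous_on UNIV f"
    unfolding f_def using \<eta> by (intro continuous_intros) auto
  have f_abs: "\<bar>f z\<bar> \<le> 1" for z
    by (simp add: f_def)
  have f_meas [measurable]: "f \<in> borel_measurable borel"
    using f_cont by (rule borel_measurable_continuous_onI)
  have f_one: "1 \<le> \<sigma> * f z" if "\<sigma> \<in> {1, - 1}" "\<eta> \<le> \<sigma> * snd z" for \<sigma> z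
    using that \<eta> by (auto simp: f_def min_def max_def divide_simps)
  define g where "g z = (\<integral>\<omega>. f (X \<delta> \<omega>) \<partial>P z)" for z
  have "bounded (range f)"
    using f_abs by (intro boundedI[of _ 1]) auto
  with feller f_cont \<delta> have g_cont: "continuous_on UNIV g"
    unfolding feller_process_def g_def by simp
  have side: "1/2 \<le> \<sigma> * g (0, x)" if \<sigma>: "\<sigma> \<in> {1, - 1}" "0 < \<sigma> * x" for \<sigma> x
  proof -
    obtain W :: "'w measure" and w Z where sol: "sde_solution \<nu> (0, x) W w Z"
        and law: "path_law (P (0, x)) X = path_law W Z"
      using assms(3) unfolding L_process_def by blast
    obtain B where B: "B \<in> sets W" "measure W B \<le> 1/4"
        "AE \<omega> in W. \<omega> \<notin> B \<longrightarrow> \<eta> \<le> \<sigma> * snd (Z \<delta> \<omega>)"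
      using sde_solution_escapes[OF assms(1,2) \<delta> \<sigma> sol, folded p_def \<eta>_def, unfolded small] by blast
    interpret W: wiener_process W w using sol by (simp add: sde_solution_def)
    have Z: "Z s \<in> W \<rightarrow>\<^sub>M borel" if "0 \<le> s" for s
      using sol that by (simp add: sde_solution_def)
    have X: "X s \<in> P (0, x) \<rightarrow>\<^sub>M borel" if "0 \<le> s" for s
      using measurable_X[OF that] by (simp add: measurable_cong_sets[OF sets_P refl])
    have "g (0, x) = (\<integral>\<omega>. f (Z \<delta> \<omega>) \<partial>W)"
      using expectation_path_law[of X, OF X f_meas less_imp_le[OF \<delta>]]
        expectation_path_law[of Z, OF Z f_meas less_imp_le[OF \<delta>]]
      by (simp add: g_def law)
    moreover have "1 - 2 * measure W B \<le> (\<integral>\<omega>. \<sigma> * f (Z \<delta> \<omega>) \<partial>W)"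
    proof (rule W.expectation_lower_bound_off_event)
      show "(\<lambda>\<omega>. \<sigma> * f (Z \<delta> \<omega>)) \<in> borel_measurable W"
        using measurable_compose[OF Z f_meas] \<delta> by simp
      show "\<bar>\<sigma> * f (Z \<delta> \<omega>)\<bar> \<le> 1" for \<omega>
        using \<sigma>(1) f_abs[of "Z \<delta> \<omega>"] by (auto simp: abs_mult)
      show "AE \<omega> in W. \<omega> \<notin> B \<longrightarrow> 1 \<le> \<sigma> * f (Z \<delta> \<omega>)"
        using B(3) by eventually_elim (use f_one[OF \<sigma>(1)] in blast)
    qed (rule B(1))
    ultimately show ?thesis using B(2) by simp
  qed
  have limit: "1/2 \<le> \<sigma> * g (0, 0)" if \<sigma>: "\<sigma> \<in> {1, - 1}" for \<sigma>
  proof -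
    have "(\<lambda>n. (0::real, \<sigma> * inverse (real (Suc n)))) \<longlonglongrightarrow> (0, \<sigma> * 0)"
      by (intro tendsto_intros LIMSEQ_inverse_real_of_nat)
    then have "(\<lambda>n. g (0, \<sigma> * inverse (real (Suc n)))) \<longlonglongrightarrow> g (0, \<sigma> * 0)"
      by (rule continuous_on_tendsto_compose[OF g_cont]) auto
    then have "(\<lambda>n. \<sigma> * g (0, \<sigma> * inverse (real (Suc n)))) \<longlonglongrightarrow> \<sigma> * g (0, 0)"
      by (intro tendsto_mult_left) simp
    moreover have "1/2 \<le> \<sigma> * g (0, \<sigma> * inverse (real (Suc n)))" for n
      using \<sigma> by (intro side) auto
    ultimately show ?thesis
      by (intro LIMSEQ_le_const) auto
  qed
  from limit[of 1] limit[of "- 1"] show False by simp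
qed

end
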